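(* Let $I$ be a set. For each $i\in I$, let $S_i$ be a near $e_i$ subsemigroup of a semitopological semigroup $T_i$ and let $p_i$ be an idempotent in $K((e_i)_{S_i}^* )$. Let us consider the product semitopological semigroup $T=\prod_{i\in I}T_i$ with box topology. Let $S=\prod_{i\in I}S_i$, $e=(e_i)_{i\in I}$ and $p=(p_i)_{i\in I}$. Consider $\prod_{i\in I}\beta S_i$ with product topology, and let $\tilde{\iota}:\beta S\rightarrow\prod_{i\in I}\beta S_i$ be the continuous extension of the inclusion $\iota: S_d\rightarrow\prod_{i\in I}\beta S_i$. Let $M=\tilde{\iota}^{-1}\{p\}\cap e_S^*$. Then $M$ is a compact subsemigroup of $e_S^*$ and $K(M)\subseteq K(e_S^* )$.
   Context: All semitopological semigroups $(T,+)$ are Hausdorff, with $x\mapsto a+x$ and $x\mapsto x+a$ continuous. For $x\in T$, $\tau_x$ is the set of neighborhoods of $x$. For $e$ an idempotent of $T$ not in a subsemigroup $S$, $S$ is a near $e$ subsemigroup of $T$ if $e\in cl_T(S)$. $S_d$ is $S$ with the discrete topology; $\beta S$ is its Stone-Čech compactification (ultrafilters on $S$) with the extended operation, and $e_S^*=\{p\in\beta S: U\cap S\in p \text{ for each } U\in\tau_e\}$, a compact subsemigroup of $\beta S$. $K(\cdot)$ denotes the smallest ideal of a compact right topological semigroup. The box topology on $\prod_{i\in I}T_i$ is generated by the sets $\prod_{i\in I}U_i$ with each $U_i$ open in $T_i$. *)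

theory Defs
  imports "HOL-Analysis.Analysis"
begin

section \<open>Semigroups on a carrier\<close>

definition semigroup_on :: "'a set \<Rightarrow> ('a \<Rightarrow> 'a \<Rightarrow> 'a) \<Rightarrow> bool" where
  "semigroup_on A f \<longleftrightarrow>
     A \<noteq> {} \<and> (\<forall>x\<in>A. \<forall>y\<in>A. f x y \<in> A) \<and>
     (\<forall>x\<in>A. \<forall>y\<in>A. \<forall>z\<in>A. f (f x y) z = f x (f y z))"

definition subsemigroup_of :: "'a set \<Rightarrow> 'a set \<Rightarrow> ('a \<Rightarrow> 'a \<Rightarrow> 'a) \<Rightarrow> bool" where
  "subsemigroup_of B A f \<longleftrightarrow> B \<noteq> {} \<and> B \<subseteq> A \<and> (\<forall>x\<in>B. \<forall>y\<in>B. f x y \<in> B)"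

definition two_sided_ideal :: "'a set \<Rightarrow> ('a \<Rightarrow> 'a \<Rightarrow> 'a) \<Rightarrow> 'a set \<Rightarrow> bool" where
  "two_sided_ideal A f J \<longleftrightarrow>
     J \<noteq> {} \<and> J \<subseteq> A \<and> (\<forall>a\<in>A. \<forall>x\<in>J. f a x \<in> J \<and> f x a \<in> J)"

text \<open>Meaningful only if a smallest ideal exists (\<open>LEAST\<close> is with respect to \<open>\<subseteq>\<close>), as it does in
  every compact right topological semigroup.\<close>

definition smallest_ideal :: "'a set \<Rightarrow> ('a \<Rightarrow> 'a \<Rightarrow> 'a) \<Rightarrow> 'a set" where
  "smallest_ideal A f = (LEAST J. two_sided_ideal A f J)"


section \<open>Semitopological semigroups\<close>

definition semitopological_semigroup :: "'a topology \<Rightarrow> ('a \<Rightarrow> 'a \<Rightarrow> 'a) \<Rightarrow> bool" where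
  "semitopological_semigroup T f \<longleftrightarrow>
     semigroup_on (topspace T) f \<and> Hausdorff_space T \<and>
     (\<forall>a\<in>topspace T. continuous_map T T (\<lambda>x. f a x) \<and> continuous_map T T (\<lambda>x. f x a))"

definition neighborhoods :: "'a topology \<Rightarrow> 'a \<Rightarrow> 'a set set" where
  "neighborhoods T x = {U. U \<subseteq> topspace T \<and> (\<exists>V. openin T V \<and> x \<in> V \<and> V \<subseteq> U)}"

definition near_subsemigroup ::
    "'a topology \<Rightarrow> ('a \<Rightarrow> 'a \<Rightarrow> 'a) \<Rightarrow> 'a \<Rightarrow> 'a set \<Rightarrow> bool" where
  "near_subsemigroup T f e S \<longleftrightarrow>
     e \<in> topspace T \<and> f e e = e \<and> subsemigroup_of S (topspace T) f \<and>
     e \<notin> S \<and> e \<in> T closure_of S"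

definition box_topology :: "('i \<Rightarrow> 'a topology) \<Rightarrow> 'i set \<Rightarrow> ('i \<Rightarrow> 'a) topology" where
  "box_topology T I =
     topology_generated_by {(\<Pi>\<^sub>E i\<in>I. U i) | U. \<forall>i\<in>I. openin (T i) (U i)}"

definition product_op ::
    "('i \<Rightarrow> 'a \<Rightarrow> 'a \<Rightarrow> 'a) \<Rightarrow> 'i set \<Rightarrow> ('i \<Rightarrow> 'a) \<Rightarrow> ('i \<Rightarrow> 'a) \<Rightarrow> ('i \<Rightarrow> 'a)" where
  "product_op f I x y = (\<lambda>i\<in>I. f i (x i) (y i))"


section \<open>The Stone-Cech compactification of a discrete semigroup\<close>

definition ultrafilter_on :: "'a set \<Rightarrow> 'a set set \<Rightarrow> bool" where
  "ultrafilter_on S p \<longleftrightarrow>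
     p \<subseteq> Pow S \<and> S \<in> p \<and> {} \<notin> p \<and>
     (\<forall>A\<in>p. \<forall>B\<in>p. A \<inter> B \<in> p) \<and>
     (\<forall>A\<in>p. \<forall>B. A \<subseteq> B \<and> B \<subseteq> S \<longrightarrow> B \<in> p) \<and>
     (\<forall>A. A \<subseteq> S \<longrightarrow> A \<in> p \<or> S - A \<in> p)"

definition principal_uf :: "'a set \<Rightarrow> 'a \<Rightarrow> 'a set set" where
  "principal_uf S x = {A. A \<subseteq> S \<and> x \<in> A}"

text \<open>The points of \<open>beta S\<close> are all the ultrafilters on \<open>S\<close> (take \<open>A = S\<close> below).\<close>

definition beta :: "'a set \<Rightarrow> 'a set set topology" where
  "beta S = topology_generated_by {{p. ultrafilter_on S p \<and> A \<in> p} | A. A \<subseteq> S}"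

text \<open>The extension of \<open>f\<close> to \<open>beta S\<close> for which \<open>p \<mapsto> p + q\<close> is continuous for every \<open>q\<close>
  and \<open>q \<mapsto> x + q\<close> is continuous for every \<open>x \<in> S\<close> (right topological convention):
  \<open>A \<in> p + q\<close> iff \<open>{x \<in> S. -x + A \<in> q} \<in> p\<close>, where \<open>-x + A = {y \<in> S. x + y \<in> A}\<close>.\<close>

definition beta_op ::
    "'a set \<Rightarrow> ('a \<Rightarrow> 'a \<Rightarrow> 'a) \<Rightarrow> 'a set set \<Rightarrow> 'a set set \<Rightarrow> 'a set set" where
  "beta_op S f p q = {A. A \<subseteq> S \<and> {x \<in> S. {y \<in> S. f x y \<in> A} \<in> q} \<in> p}"

text \<open>The continuous extension to \<open>beta S\<close> of a map \<open>g\<close> from the discrete space \<open>S\<close> to a compact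
  Hausdorff space \<open>Y\<close>; \<open>S\<close> sits in \<open>beta S\<close> as the principal ultrafilters. The condition
  \<open>h \<in> extensional _\<close> fixes the irrelevant values outside \<open>beta S\<close>, so that \<open>h\<close> is unique.\<close>

definition beta_extension :: "'a set \<Rightarrow> 'b topology \<Rightarrow> ('a \<Rightarrow> 'b) \<Rightarrow> 'a set set \<Rightarrow> 'b" where
  "beta_extension S Y g =
     (THE h. h \<in> extensional (topspace (beta S)) \<and> continuous_map (beta S) Y h \<and>
             (\<forall>x\<in>S. h (principal_uf S x) = g x))"

definition e_star :: "'a topology \<Rightarrow> 'a \<Rightarrow> 'a set \<Rightarrow> 'a set set set" where
  "e_star T e S = {p \<in> topspace (beta S). \<forall>U\<in>neighborhoods T e. U \<inter> S \<in> p}"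

end

theory Submission
  imports Defs
begin

text \<open>The continuous extension of \<open>\<iota>\<close> sends \<open>q\<close> to its coordinate images, and each coordinate map is a
  homomorphism into \<open>(e\<^sub>i)*\<close>; hence \<open>M\<close> is a compact semigroup, nonempty because boxes with
  sides in the \<open>p\<^sub>i\<close> have the finite intersection property. Since \<open>M \<inter> K(e*)\<close> is an ideal of \<open>M\<close>
  as soon as it is nonempty, one element of it suffices. Take an idempotent \<open>m\<close> of \<open>M\<close>, some
  \<open>k \<in> K(e*)\<close> and an idempotent \<open>r\<close> of the compact left ideal \<open>e* + k + m\<close>. Then \<open>m + r\<close> is an
  idempotent of \<open>K(e*)\<close> below \<open>m\<close>, so its coordinate images are idempotents below the minimal
  idempotents \<open>p\<^sub>i\<close> and therefore equal to them: \<open>m + r \<in> M\<close>.\<close>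

section \<open>Compact right topological semigroups\<close>

text \<open>The carrier \<open>E\<close> is a compact subset of an ambient space \<open>X\<close>,
  so that the single space \<open>beta SS\<close> can serve \<open>e_star\<close>, \<open>M\<close>
  and the left ideal \<open>N\<close> at once.\<close>

locale compact_right_topological_semigroup =
  fixes X :: "'b topology" and E :: "'b set" and f :: "'b \<Rightarrow> 'b \<Rightarrow> 'b"
  assumes Hausdorff: "Hausdorff_space X"
    and compact: "compactin X E"
    and semigroup: "semigroup_on E f"
    and continuous: "\<And>q. q \<in> E \<Longrightarrow> continuous_map (subtopology X E) X (\<lambda>p. f p q)"

text \<open>Zorn's lemma for reversed inclusion: the members of a chain are closed by the Hausdorff
  property and have the finite intersection property inside the compact set \<open>E\<close>, so
  their intersection is again nonempty and compact. The parameter \<open>P\<close> will be closure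
  under the operation, or being a left ideal.\<close>

lemma minimal_compact_exists:
  assumes X: "Hausdorff_space X" and E: "compactin X E" "E \<noteq> {}" "P E"
    and Inter: "\<And>\<C>. \<C> \<noteq> {} \<Longrightarrow> \<forall>A\<in>\<C>. A \<subseteq> E \<and> P A \<Longrightarrow> P (\<Inter>\<C>)"
  obtains A where "A \<subseteq> E" "compactin X A" "A \<noteq> {}" "P A"
    "\<And>B. B \<subseteq> A \<Longrightarrow> compactin X B \<Longrightarrow> B \<noteq> {} \<Longrightarrow> P B \<Longrightarrow> B = A"
proof -
  define F where "F = {A. A \<subseteq> E \<and> compactin X A \<and> A \<noteq> {} \<and> P A}"
  let ?R = "\<lambda>A B :: 'a set. B \<subseteq> A"
  have "\<exists>m\<in>F. \<forall>a\<in>F. ?R m a \<longrightarrow> a = m"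
  proof (rule predicate_Zorn)
    show "partial_order_on F (relation_of ?R F)"
      by (rule partial_order_on_relation_ofI) auto
  next
    fix \<C> assume C: "\<C> \<in> Chains (relation_of ?R F)"
    have CF: "\<C> \<subseteq> F"
      using Chains_relation_of[OF C] .
    have tot: "A \<subseteq> B \<or> B \<subseteq> A" if "A \<in> \<C>" "B \<in> \<C>" for A B
      using C that by (auto simp: Chains_def relation_of_def)
    show "\<exists>u\<in>F. \<forall>a\<in>\<C>. ?R a u"
    proof (cases "\<C> = {}")
      case True
      then show ?thesis using E by (auto simp: F_def)
    next
      case False
      have closed: "closedin X A" if "A \<in> \<C>" for A
        using that CF X by (auto simp: F_def intro: compactin_imp_closedin)
      \<comment> \<open>A finite subfamily of a chain has a smallest member; for the empty subfamily
        any member of the chain will do.\<close>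
      have mono: "\<exists>A\<in>\<C>. A \<subseteq> \<Inter>\<F>" if "finite \<F>" "\<F> \<subseteq> \<C>" for \<F>
        using that
      proof (induction rule: finite_induct)
        case empty
        then show ?case using False by auto
      next
        case (insert B \<F>)
        then obtain A where A: "A \<in> \<C>" "A \<subseteq> \<Inter>\<F>" "B \<in> \<C>" by auto
        show ?case
        proof (cases "A \<subseteq> B")
          case True
          with A show ?thesis by auto
        next
          case False
          with A tot[of A B] have "B \<subseteq> \<Inter>(insert B \<F>)" by auto
          with A show ?thesis by blast
        qed
      qed
      have "E \<inter> \<Inter>\<C> \<noteq> {}"
      proof -
        have "E \<inter> \<Inter>\<F> \<noteq> {}" if F: "finite \<F>" "\<F> \<subseteq> \<C>" for \<F>
        proof -
          obtain A where "A \<in> \<C>" "A \<subseteq> \<Inter>\<F>" using mono[OF F] by blast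
          moreover then have "A \<subseteq> E" "A \<noteq> {}" using CF by (auto simp: F_def)
          ultimately show ?thesis by blast
        qed
        with closed have "(\<forall>A\<in>\<C>. closedin X A) \<and> (\<forall>\<F>. finite \<F> \<and> \<F> \<subseteq> \<C> \<longrightarrow> E \<inter> \<Inter>\<F> \<noteq> {})"
          by presburger
        then show ?thesis
          by (rule E(1)[unfolded compactin_fip, THEN conjunct2, THEN spec, THEN mp])
      qed
      moreover have "closedin X (\<Inter>\<C>)"
        using closed False by (simp add: closedin_Inter)
      moreover have "\<Inter>\<C> \<subseteq> E" using False CF by (auto simp: F_def)
      moreover have "P (\<Inter>\<C>)" using Inter[OF False] CF by (auto simp: F_def)
      ultimately have "\<Inter>\<C> \<in> F"
        using closed_compactin[OF E(1)] by (auto simp: F_def)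
      then show ?thesis by (auto intro: Inter_lower)
    qed
  qed
  then obtain A where A: "A \<in> F" and min: "\<And>B. B \<in> F \<Longrightarrow> B \<subseteq> A \<Longrightarrow> B = A" by blast
  show ?thesis
  proof (rule that[of A])
    show "B = A" if "B \<subseteq> A" "compactin X B" "B \<noteq> {}" "P B" for B
      using that A by (intro min) (auto simp: F_def)
  qed (use A in \<open>auto simp: F_def\<close>)
qed

context compact_right_topological_semigroup
begin

lemma nonempty: "E \<noteq> {}"
  and closed: "x \<in> E \<Longrightarrow> y \<in> E \<Longrightarrow> f x y \<in> E"
  and assoc: "x \<in> E \<Longrightarrow> y \<in> E \<Longrightarrow> z \<in> E \<Longrightarrow> f (f x y) z = f x (f y z)"
  using semigroup by (auto simp: semigroup_on_def)

lemma subsemigroup: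
  assumes "C \<subseteq> E" "C \<noteq> {}" "compactin X C" "\<And>x y. x \<in> C \<Longrightarrow> y \<in> C \<Longrightarrow> f x y \<in> C"
  shows "compact_right_topological_semigroup X C f"
proof
  show "semigroup_on C f"
    using assms assoc by (auto simp: semigroup_on_def subset_iff)
  show "continuous_map (subtopology X C) X (\<lambda>p. f p q)" if "q \<in> C" for q
    using continuous[of q] that assms(1) by (meson continuous_map_from_subtopology_mono subsetD)
qed (use assms Hausdorff in auto)

lemma compactin_right_translate:
  assumes "compactin X C" "C \<subseteq> E" "q \<in> E"
  shows "compactin X ((\<lambda>p. f p q) ` C)"
  using image_compactin[OF _ continuous[OF assms(3)]] assms(1,2) by (simp add: compactin_subtopology)

lemma compactin_right_fibre:
  assumes "compactin X C" "C \<subseteq> E" "q \<in> E" "z \<in> E"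
  shows "compactin X {p \<in> C. f p q = z}"
proof -
  have z: "closedin X {z}"
    using assms(4) compact Hausdorff compactin_subset_topspace
    by (metis closedin_Hausdorff_sing_eq subsetD)
  have "continuous_map (subtopology X C) X (\<lambda>p. f p q)"
    using continuous[OF assms(3)] assms(2) by (rule continuous_map_from_subtopology_mono)
  then have "closedin (subtopology X C) {p \<in> topspace (subtopology X C). f p q \<in> {z}}"
    using z by (rule closedin_continuous_map_preimage)
  moreover have "topspace (subtopology X C) = C"
    using assms(1) by (meson compactin_subset_topspace topspace_subtopology_subset)
  ultimately have "closedin (subtopology X C) {p \<in> C. f p q = z}" by (simp only: singleton_iff)
  then show ?thesis
    using assms(1) closedin_compact_space compactin_subspace compactin_subtopology by metis
qed

text \<open>The Ellis-Numakura argument: for \<open>u\<close> in a minimal compact subsemigroup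
  \<open>A\<close>, first \<open>A + u\<close> and then the solutions \<open>p\<close> of
  \<open>p + u = u\<close> are compact subsemigroups of \<open>A\<close>, hence all of
  \<open>A\<close>; so \<open>u\<close> itself is a solution.\<close>

lemma idempotent_exists: "\<exists>u\<in>E. f u u = u"
proof -
  have "\<forall>x\<in>E. \<forall>y\<in>E. f x y \<in> E" using closed by blast
  then obtain A where A: "A \<subseteq> E" "compactin X A" "A \<noteq> {}" "\<forall>x\<in>A. \<forall>y\<in>A. f x y \<in> A"
    and min: "\<And>B. B \<subseteq> A \<Longrightarrow> compactin X B \<Longrightarrow> B \<noteq> {} \<Longrightarrow> \<forall>x\<in>B. \<forall>y\<in>B. f x y \<in> B \<Longrightarrow> B = A"
    by (rule minimal_compact_exists[OF Hausdorff compact nonempty,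
          where P = "\<lambda>A. \<forall>x\<in>A. \<forall>y\<in>A. f x y \<in> A"]) auto
  obtain u where u: "u \<in> A" using A(3) by blast
  have "(\<lambda>p. f p u) ` A = A"
  proof (rule min)
    show "compactin X ((\<lambda>p. f p u) ` A)" using A u by (auto intro: compactin_right_translate)
    show "\<forall>x\<in>(\<lambda>p. f p u) ` A. \<forall>y\<in>(\<lambda>p. f p u) ` A. f x y \<in> (\<lambda>p. f p u) ` A"
    proof clarify
      fix x y assume xy: "x \<in> A" "y \<in> A"
      have "f (f x u) (f y u) = f (f (f x u) y) u"
        using A xy u by (intro assoc[symmetric]) auto
      then show "f (f x u) (f y u) \<in> (\<lambda>p. f p u) ` A" using A xy u by auto
    qed
  qed (use A u in auto)
  \<comment> \<open>The witness \<open>v\<close> makes the fibre over \<open>u\<close> nonempty, so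
    that minimality of \<open>A\<close> applies a second time.\<close>
  then obtain v where v: "v \<in> A" "f v u = u" using u by (metis imageE)
  have "{p \<in> A. f p u = u} = A"
  proof (rule min)
    show "compactin X {p \<in> A. f p u = u}" using A u by (auto intro!: compactin_right_fibre)
    show "\<forall>x\<in>{p \<in> A. f p u = u}. \<forall>y\<in>{p \<in> A. f p u = u}. f x y \<in> {p \<in> A. f p u = u}"
    proof clarify
      fix x y assume xy: "x \<in> A" "y \<in> A" "f x u = u" "f y u = u"
      then have "f (f x y) u = u" using A u by (subst assoc) auto
      then show "f x y \<in> A \<and> f (f x y) u = u" using A xy by auto
    qed
  qed (use v in auto)
  then show ?thesis using u A by blast
qed

text \<open>Zorn's lemma gives minimality among compact left ideals only, but \<open>E + y\<close>
  is compact for every \<open>y\<close>, so it equals \<open>L\<close>; the last clause records this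
  without topology.\<close>

lemma minimal_left_ideal_exists:
  obtains L where "L \<subseteq> E" "L \<noteq> {}" "\<forall>x\<in>E. \<forall>y\<in>L. f x y \<in> L"
    "\<forall>y\<in>L. \<forall>z\<in>L. \<exists>x\<in>E. f x y = z"
proof -
  have "\<forall>x\<in>E. \<forall>y\<in>E. f x y \<in> E" using closed by blast
  then obtain L where L: "L \<subseteq> E" "compactin X L" "L \<noteq> {}" "\<forall>x\<in>E. \<forall>y\<in>L. f x y \<in> L"
    and min: "\<And>B. B \<subseteq> L \<Longrightarrow> compactin X B \<Longrightarrow> B \<noteq> {} \<Longrightarrow> \<forall>x\<in>E. \<forall>y\<in>B. f x y \<in> B \<Longrightarrow> B = L"
    by (rule minimal_compact_exists[OF Hausdorff compact nonempty,
          where P = "\<lambda>A. \<forall>x\<in>E. \<forall>y\<in>A. f x y \<in> A"]) auto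
  have "\<exists>x\<in>E. f x y = z" if yz: "y \<in> L" "z \<in> L" for y z
  proof -
    have "(\<lambda>p. f p y) ` E = L"
    proof (rule min)
      show "compactin X ((\<lambda>p. f p y) ` E)"
        using L yz compact by (auto intro: compactin_right_translate)
      show "\<forall>x\<in>E. \<forall>w\<in>(\<lambda>p. f p y) ` E. f x w \<in> (\<lambda>p. f p y) ` E"
      proof clarify
        fix x w assume xw: "x \<in> E" "w \<in> E"
        then have "f x (f w y) = f (f x w) y" using L yz assoc[of x w y] by auto
        then show "f x (f w y) \<in> (\<lambda>p. f p y) ` E" using xw closed by auto
      qed
    qed (use L yz nonempty in auto)
    then show ?thesis using yz by (metis imageE)
  qed
  then show ?thesis using that[of L] L by blast
qed

text \<open>The smallest ideal is \<open>L + E\<close> for any minimal left ideal \<open>L\<close>; its elements \<open>p\<close> generate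
  minimal left ideals \<open>E + p\<close>, which is the last clause.\<close>

lemma smallest_ideal_properties:
  shows two_sided_ideal_smallest_ideal: "two_sided_ideal E f (smallest_ideal E f)"
    and smallest_ideal_least: "two_sided_ideal E f J \<Longrightarrow> smallest_ideal E f \<subseteq> J"
    and smallest_ideal_left_simple:
      "p \<in> smallest_ideal E f \<Longrightarrow> y \<in> E \<Longrightarrow> \<exists>x\<in>E. f x (f y p) = p"
proof -
  obtain L where L: "L \<subseteq> E" "L \<noteq> {}" and left: "\<And>x y. x \<in> E \<Longrightarrow> y \<in> L \<Longrightarrow> f x y \<in> L"
    and simple: "\<And>y z. y \<in> L \<Longrightarrow> z \<in> L \<Longrightarrow> \<exists>x\<in>E. f x y = z"
    using minimal_left_ideal_exists by metis
  have LE: "l \<in> E" if "l \<in> L" for l using L that by auto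
  define K where "K = {f l x | l x. l \<in> L \<and> x \<in> E}"
  have K: "two_sided_ideal E f K"
    unfolding two_sided_ideal_def
  proof (intro conjI ballI)
    show "K \<noteq> {}" using L nonempty by (auto simp: K_def)
    show "K \<subseteq> E" using LE closed by (auto simp: K_def)
    fix a k assume a: "a \<in> E" and "k \<in> K"
    then obtain l x where k: "l \<in> L" "x \<in> E" "k = f l x" by (auto simp: K_def)
    have "f a k = f (f a l) x" "f k a = f l (f x a)" using k a LE assoc by auto
    then show "f a k \<in> K" "f k a \<in> K" using k a left closed unfolding K_def by blast+
  qed
  \<comment> \<open>For \<open>j\<close> in \<open>J\<close>, the sum \<open>j + l\<close> lies in
    both \<open>J\<close> and \<open>L\<close>. Left multiplication brings it back to
    \<open>l\<close>, so \<open>J\<close> contains \<open>L\<close> and with it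
    \<open>L + E\<close>.\<close>
  have least: "K \<subseteq> J" if J: "two_sided_ideal E f J" for J
  proof
    fix k assume "k \<in> K"
    then obtain l x where k: "l \<in> L" "x \<in> E" "k = f l x" by (auto simp: K_def)
    obtain j where j: "j \<in> J" "j \<in> E" using J by (auto simp: two_sided_ideal_def)
    obtain y where y: "y \<in> E" "f y (f j l) = l" using simple[of "f j l" l] left j k by blast
    have "f j l \<in> J" using J j LE k by (auto simp: two_sided_ideal_def)
    then have "l \<in> J" using J y by (metis two_sided_ideal_def)
    then show "k \<in> J" using J k by (auto simp: two_sided_ideal_def)
  qed
  have eq: "smallest_ideal E f = K"
    unfolding smallest_ideal_def using K least by (intro Least_equality) auto
  show "two_sided_ideal E f (smallest_ideal E f)" using K eq by simp
  show "smallest_ideal E f \<subseteq> J" if "two_sided_ideal E f J" using least that eq by simp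
  assume "p \<in> smallest_ideal E f" and y: "y \<in> E"
  then obtain l x where p: "l \<in> L" "x \<in> E" "p = f l x" by (auto simp: eq K_def)
  \<comment> \<open>The element \<open>y + l\<close> stays in \<open>L\<close>, so left
    multiplication can undo \<open>y\<close> there; the right factor \<open>x\<close> is carried
    along by associativity.\<close>
  obtain z where z: "z \<in> E" "f z (f y l) = l" using simple[of "f y l" l] left y p by blast
  have "f y p = f (f y l) x" using p y LE by (simp add: assoc)
  then have "f z (f y p) = f (f z (f y l)) x" using p(1,2) y z(1) LE closed by (simp add: assoc)
  then show "\<exists>x\<in>E. f x (f y p) = p" using z p by auto
qed

lemma smallest_ideal_subset: "smallest_ideal E f \<subseteq> E"
  using two_sided_ideal_smallest_ideal by (simp add: two_sided_ideal_def)

text \<open>Left simplicity writes \<open>p\<close> as \<open>x + w\<close>, on which the idempotent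
  \<open>w\<close> acts trivially from the right; so \<open>p + w\<close> equals both
  \<open>p\<close> and \<open>w\<close>.\<close>

lemma smallest_ideal_idempotent_minimal:
  assumes "p \<in> smallest_ideal E f" "w \<in> E" "f w w = w" "f w p = w" "f p w = w"
  shows "w = p"
proof -
  obtain x where x: "x \<in> E" "f x w = p"
    using smallest_ideal_left_simple[OF assms(1,2)] assms(4) by auto
  then have "f p w = p" using assoc[of x w w] assms by auto
  then show ?thesis using assms(5) by simp
qed

end

section \<open>The space of ultrafilters\<close>

text \<open>A generating family stable under binary intersection is already a base at the points it
  covers. This serves both \<open>beta\<close> and \<open>box_topology\<close>.\<close>

lemma openin_generated_intersection_stable:
  assumes "openin (topology_generated_by \<B>) V" "x \<in> V"
    and stable: "\<And>A B. A \<in> \<B> \<Longrightarrow> B \<in> \<B> \<Longrightarrow> A \<inter> B \<in> \<B>"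
  obtains B where "B \<in> \<B>" "x \<in> B" "B \<subseteq> V"
proof -
  have "generate_topology_on \<B> V" using assms(1) by (simp add: openin_topology_generated_by_iff)
  then have "x \<in> V \<longrightarrow> (\<exists>B\<in>\<B>. x \<in> B \<and> B \<subseteq> V)"
  proof induction
    case (Int a b)
    show ?case
    proof
      assume "x \<in> a \<inter> b"
      then obtain A B where AB: "A \<in> \<B>" "x \<in> A" "A \<subseteq> a" "B \<in> \<B>" "x \<in> B" "B \<subseteq> b"
        using Int by blast
      then show "\<exists>C\<in>\<B>. x \<in> C \<and> C \<subseteq> a \<inter> b"
        by (intro bexI[of _ "A \<inter> B"] stable) auto
    qed
  next
    case (UN K)
    then show ?case by (meson Sup_upper2 UnionE)
  qed auto
  then show ?thesis using that assms(2) by blast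
qed

lemma
  assumes "ultrafilter_on S p"
  shows ultrafilter_on_subset: "A \<in> p \<Longrightarrow> A \<subseteq> S"
    and ultrafilter_on_space: "S \<in> p"
    and ultrafilter_on_empty: "{} \<notin> p"
    and ultrafilter_on_Int: "A \<in> p \<Longrightarrow> B \<in> p \<Longrightarrow> A \<inter> B \<in> p"
    and ultrafilter_on_mono: "A \<in> p \<Longrightarrow> A \<subseteq> B \<Longrightarrow> B \<subseteq> S \<Longrightarrow> B \<in> p"
    and ultrafilter_on_compl: "A \<subseteq> S \<Longrightarrow> S - A \<in> p \<longleftrightarrow> A \<notin> p"
proof -
  show "A \<subseteq> S" if "A \<in> p" using assms that by (auto simp: ultrafilter_on_def)
  show "S \<in> p" and 1: "{} \<notin> p" using assms by (auto simp: ultrafilter_on_def)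
  show 2: "A \<inter> B \<in> p" if "A \<in> p" "B \<in> p" for A B using assms that by (auto simp: ultrafilter_on_def)
  show "B \<in> p" if "A \<in> p" "A \<subseteq> B" "B \<subseteq> S" using assms that unfolding ultrafilter_on_def by blast
  have "A \<inter> (S - A) = {}" by blast
  then show "S - A \<in> p \<longleftrightarrow> A \<notin> p" if "A \<subseteq> S"
    using 1 2[of A "S - A"] assms that unfolding ultrafilter_on_def by metis
qed

lemma ultrafilter_on_Int_iff:
  assumes "ultrafilter_on S p" "A \<subseteq> S" "B \<subseteq> S"
  shows "A \<inter> B \<in> p \<longleftrightarrow> A \<in> p \<and> B \<in> p"
  using assms by (meson inf_le1 inf_le2 ultrafilter_on_Int ultrafilter_on_mono)

text \<open>Maximality: a set in \<open>q\<close> but not in \<open>p\<close> would put its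
  complement into \<open>p\<close>, hence into \<open>q\<close>. Later equalities of ultrafilters
  are reduced to one inclusion this way.\<close>

lemma ultrafilter_on_subset_eq:
  assumes "ultrafilter_on S p" "ultrafilter_on S q" "p \<subseteq> q"
  shows "p = q"
proof
  show "q \<subseteq> p"
  proof
    fix A assume A: "A \<in> q"
    then have "S - A \<notin> q" using assms ultrafilter_on_subset ultrafilter_on_compl by metis
    then show "A \<in> p" using A assms ultrafilter_on_subset ultrafilter_on_compl by (metis subsetD)
  qed
qed fact

lemma ultrafilter_on_principal_uf: "x \<in> S \<Longrightarrow> ultrafilter_on S (principal_uf S x)"
  by (auto simp: ultrafilter_on_def principal_uf_def)

text \<open>A family that is maximal among those extending \<open>D\<close> with the finite
  intersection property is an ultrafilter.\<close>

lemma ultrafilter_exists: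
  assumes "D \<subseteq> Pow S" and fip: "\<And>\<F>. finite \<F> \<Longrightarrow> \<F> \<subseteq> D \<Longrightarrow> S \<inter> \<Inter>\<F> \<noteq> {}"
  obtains p where "ultrafilter_on S p" "D \<subseteq> p"
proof -
  \<comment> \<open>Intersecting with \<open>S\<close> matters for the empty subfamily, whose
    intersection is the whole type: the condition then says that \<open>S\<close> is
    nonempty.\<close>
  define Z where "Z = {G. D \<subseteq> G \<and> G \<subseteq> Pow S \<and> (\<forall>\<F>. finite \<F> \<and> \<F> \<subseteq> G \<longrightarrow> S \<inter> \<Inter>\<F> \<noteq> {})}"
  have "\<exists>p\<in>Z. \<forall>G\<in>Z. p \<subseteq> G \<longrightarrow> G = p"
  proof (rule subset_Zorn_nonempty)
    have "D \<in> Z" unfolding Z_def using assms(1) by (intro CollectI conjI allI impI fip) auto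
    then show "Z \<noteq> {}" by blast
  next
    fix \<C> assume C: "\<C> \<noteq> {}" "subset.chain Z \<C>"
    then have CZ: "\<C> \<subseteq> Z" by (simp add: subset.chain_def)
    have "S \<inter> \<Inter>\<F> \<noteq> {}" if F: "finite \<F>" "\<F> \<subseteq> \<Union>\<C>" for \<F>
    proof -
      obtain G where "G \<in> \<C>" "\<F> \<subseteq> G" using finite_subset_Union_chain[OF F C] .
      then show ?thesis using CZ F by (auto simp: Z_def)
    qed
    moreover have "D \<subseteq> G \<and> G \<subseteq> Pow S" if "G \<in> \<C>" for G using that CZ by (simp add: Z_def subset_iff)
    then have "D \<subseteq> \<Union>\<C>" "\<Union>\<C> \<subseteq> Pow S" using C(1) by blast+
    ultimately show "\<Union>\<C> \<in> Z" unfolding Z_def by simp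
  qed
  then obtain p where p: "p \<in> Z" and max: "\<And>G. G \<in> Z \<Longrightarrow> p \<subseteq> G \<Longrightarrow> G = p" by blast
  have pfip: "S \<inter> \<Inter>\<F> \<noteq> {}" if "finite \<F>" "\<F> \<subseteq> p" for \<F> using p that by (auto simp: Z_def)
  \<comment> \<open>By maximality, a set that meets every finite intersection from \<open>p\<close>
    is already in \<open>p\<close>. Membership in the filter axioms below is checked with this
    criterion.\<close>
  have mem: "A \<in> p" if A: "A \<subseteq> S" "\<And>\<F>. finite \<F> \<Longrightarrow> \<F> \<subseteq> p \<Longrightarrow> A \<inter> (S \<inter> \<Inter>\<F>) \<noteq> {}" for A
  proof -
    have "S \<inter> \<Inter>\<F> \<noteq> {}" if F: "finite \<F>" "\<F> \<subseteq> insert A p" for \<F>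
    proof -
      have "A \<inter> (S \<inter> \<Inter>(\<F> - {A})) \<noteq> {}" using F by (intro A(2)) auto
      then show ?thesis by blast
    qed
    then have "insert A p \<in> Z" using p A(1) by (auto simp: Z_def)
    then show ?thesis using max[of "insert A p"] by auto
  qed
  have "ultrafilter_on S p"
    unfolding ultrafilter_on_def
  proof (intro conjI ballI allI impI)
    show "p \<subseteq> Pow S" using p by (auto simp: Z_def)
    show "S \<in> p" using pfip by (intro mem) auto
    show "{} \<notin> p" using pfip[of "{{}}"] by auto
  next
    fix A B assume AB: "A \<in> p" "B \<in> p"
    show "A \<inter> B \<in> p"
    proof (rule mem)
      show "A \<inter> B \<subseteq> S" using p AB by (auto simp: Z_def)
      fix \<F> assume "finite \<F>" "\<F> \<subseteq> p"
      then show "A \<inter> B \<inter> (S \<inter> \<Inter>\<F>) \<noteq> {}" using AB pfip[of "insert A (insert B \<F>)"] by auto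
    qed
  next
    fix A B assume AB: "A \<in> p" "A \<subseteq> B \<and> B \<subseteq> S"
    show "B \<in> p"
    proof (rule mem)
      fix \<F> assume "finite \<F>" "\<F> \<subseteq> p"
      then show "B \<inter> (S \<inter> \<Inter>\<F>) \<noteq> {}" using AB pfip[of "insert A \<F>"] by auto
    qed (use AB in auto)
  next
    fix A assume A: "A \<subseteq> S"
    show "A \<in> p \<or> S - A \<in> p"
    proof (rule ccontr)
      assume "\<not> ?thesis"
      \<comment> \<open>If neither set were in \<open>p\<close>, one finite intersection would miss
        \<open>A\<close> and another would miss \<open>S - A\<close>; together they would miss
        \<open>S\<close>.\<close>
      then obtain \<F> \<G> where F: "finite \<F>" "\<F> \<subseteq> p" "A \<inter> (S \<inter> \<Inter>\<F>) = {}"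
        and G: "finite \<G>" "\<G> \<subseteq> p" "(S - A) \<inter> (S \<inter> \<Inter>\<G>) = {}"
        using mem[of A] mem[of "S - A"] A by (metis Diff_subset)
      moreover have "S \<inter> \<Inter>(\<F> \<union> \<G>) \<subseteq> (A \<inter> (S \<inter> \<Inter>\<F>)) \<union> ((S - A) \<inter> (S \<inter> \<Inter>\<G>))" by blast
      ultimately have "S \<inter> \<Inter>(\<F> \<union> \<G>) = {}" by simp
      then show False using pfip[of "\<F> \<union> \<G>"] F G by auto
    qed
  qed
  then show ?thesis using that p by (auto simp: Z_def)
qed

section \<open>The topology of \<open>beta S\<close> and continuous maps into it\<close>

lemma openin_beta_basis: "A \<subseteq> S \<Longrightarrow> openin (beta S) {p. ultrafilter_on S p \<and> A \<in> p}"
  unfolding beta_def by (rule topology_generated_by_Basis) blast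

lemma topspace_beta: "topspace (beta S) = {p. ultrafilter_on S p}"
  unfolding beta_def topology_generated_by_topspace
  by (auto intro: ultrafilter_on_space)

lemma openin_betaD:
  assumes "openin (beta S) U" "q \<in> U"
  obtains A where "A \<in> q" "A \<subseteq> S" "{p. ultrafilter_on S p \<and> A \<in> p} \<subseteq> U"
proof -
  obtain B where "B \<in> {{p. ultrafilter_on S p \<and> A \<in> p} | A. A \<subseteq> S}" "q \<in> B" "B \<subseteq> U"
  proof (rule openin_generated_intersection_stable[OF assms[unfolded beta_def]])
    fix P Q assume "P \<in> {{p. ultrafilter_on S p \<and> A \<in> p} | A. A \<subseteq> S}"
      "Q \<in> {{p. ultrafilter_on S p \<and> A \<in> p} | A. A \<subseteq> S}"
    then obtain A B where AB: "A \<subseteq> S" "B \<subseteq> S" "P = {p. ultrafilter_on S p \<and> A \<in> p}"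
      "Q = {p. ultrafilter_on S p \<and> B \<in> p}" by blast
    then have "P \<inter> Q = {p. ultrafilter_on S p \<and> A \<inter> B \<in> p}"
      by (auto simp: ultrafilter_on_Int_iff)
    then show "P \<inter> Q \<in> {{p. ultrafilter_on S p \<and> A \<in> p} | A. A \<subseteq> S}"
      using AB by blast
  qed blast
  then show ?thesis using that by blast
qed

lemma Hausdorff_space_beta: "Hausdorff_space (beta S)"
  unfolding Hausdorff_space_def
proof (intro allI impI)
  fix p q assume pq: "p \<in> topspace (beta S) \<and> q \<in> topspace (beta S) \<and> p \<noteq> q"
  then have uf: "ultrafilter_on S p" "ultrafilter_on S q" by (auto simp: topspace_beta)
  then obtain A where A: "A \<in> p" "A \<notin> q" using pq ultrafilter_on_subset_eq by blast
  then have AS: "A \<subseteq> S" using uf ultrafilter_on_subset by blast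
  let ?U = "\<lambda>A. {p. ultrafilter_on S p \<and> A \<in> p}"
  have "openin (beta S) (?U A)" "openin (beta S) (?U (S - A))"
    using AS by (auto intro: openin_beta_basis)
  moreover have "p \<in> ?U A" "q \<in> ?U (S - A)" "disjnt (?U A) (?U (S - A))"
    using A AS uf by (auto simp: ultrafilter_on_compl disjnt_def)
  ultimately show "\<exists>U V. openin (beta S) U \<and> openin (beta S) V \<and> p \<in> U \<and> q \<in> V \<and> disjnt U V"
    by blast
qed

lemma ultrafilter_on_finite_Union:
  assumes "ultrafilter_on S p" "finite \<F>" "\<F> \<subseteq> Pow S" "\<Union>\<F> \<in> p"
  shows "\<exists>A\<in>\<F>. A \<in> p"
  using assms(2-)
proof (induction rule: finite_induct)
  case empty
  then show ?case using assms(1) ultrafilter_on_empty by auto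
next
  case (insert A \<F>)
  show ?case
  proof (cases "A \<in> p")
    case False
    then have "S - A \<in> p" using insert assms(1) by (simp add: ultrafilter_on_compl)
    then have "(S - A) \<inter> \<Union>(insert A \<F>) \<in> p" using insert assms(1) ultrafilter_on_Int by metis
    then have "\<Union>\<F> \<in> p"
      by (rule ultrafilter_on_mono[OF assms(1)]) (use insert in auto)
    then show ?thesis using insert by auto
  qed auto
qed

text \<open>The cover is replaced by the family \<open>\<A>\<close> of subsets of \<open>S\<close>
  whose basic sets fit into one of its members. If no finite part of \<open>\<A>\<close> covered
  \<open>S\<close>, the complements would extend to an ultrafilter outside every member of the
  cover. A finite part that does cover \<open>S\<close> has an element in each ultrafilter.\<close>

lemma compact_space_beta: "compact_space (beta S)"
  unfolding compact_space_alt
proof (intro allI impI)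
  fix \<U> assume U: "(\<forall>U\<in>\<U>. openin (beta S) U) \<and> topspace (beta S) \<subseteq> \<Union>\<U>"
  let ?U = "\<lambda>A. {p. ultrafilter_on S p \<and> A \<in> p}"
  define \<A> where "\<A> = {A. A \<subseteq> S \<and> (\<exists>U\<in>\<U>. ?U A \<subseteq> U)}"
  have "\<exists>\<G>. finite \<G> \<and> \<G> \<subseteq> \<A> \<and> S \<subseteq> \<Union>\<G>"
  proof (rule ccontr)
    assume no: "\<not> ?thesis"
    obtain q where q: "ultrafilter_on S q" "(\<lambda>A. S - A) ` \<A> \<subseteq> q"
    proof (rule ultrafilter_exists)
      show "(\<lambda>A. S - A) ` \<A> \<subseteq> Pow S" by auto
      fix \<F> assume "finite \<F>" "\<F> \<subseteq> (\<lambda>A. S - A) ` \<A>"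
      then obtain \<G> where G: "finite \<G>" "\<G> \<subseteq> \<A>" "\<F> = (\<lambda>A. S - A) ` \<G>"
        by (meson finite_subset_image)
      then have "\<not> S \<subseteq> \<Union>\<G>" using no by blast
      then show "S \<inter> \<Inter>\<F> \<noteq> {}" using G by auto
    qed
    obtain U where U1: "U \<in> \<U>" "q \<in> U" "openin (beta S) U" using U q by (auto simp: topspace_beta)
    obtain A where A: "A \<in> q" "A \<subseteq> S" "?U A \<subseteq> U" using openin_betaD[OF U1(3,2)] .
    then have "A \<in> \<A>" using U1 by (auto simp: \<A>_def)
    then have "S - A \<in> q" using q by auto
    then show False using A q by (simp add: ultrafilter_on_compl)
  qed
  then obtain \<G> where G: "finite \<G>" "\<G> \<subseteq> \<A>" "S \<subseteq> \<Union>\<G>" by blast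
  then have "\<forall>A\<in>\<G>. \<exists>U\<in>\<U>. ?U A \<subseteq> U" by (auto simp: \<A>_def)
  then obtain V where V: "\<And>A. A \<in> \<G> \<Longrightarrow> V A \<in> \<U> \<and> ?U A \<subseteq> V A" by metis
  have "\<G> \<subseteq> Pow S" "\<Union>\<G> = S" using G by (auto simp: \<A>_def)
  then have "\<exists>A\<in>\<G>. A \<in> q" if "ultrafilter_on S q" for q
    using ultrafilter_on_finite_Union[OF that G(1)] ultrafilter_on_space[OF that] by simp
  then have "topspace (beta S) \<subseteq> \<Union>(V ` \<G>)"
    using V unfolding topspace_beta by blast
  then show "\<exists>\<F>. finite \<F> \<and> \<F> \<subseteq> \<U> \<and> topspace (beta S) \<subseteq> \<Union>\<F>"
    using G V by (intro exI[of _ "V ` \<G>"]) auto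
qed

text \<open>Omitting a set \<open>A\<close> of \<open>D\<close> amounts to containing
  \<open>S - A\<close>, which is an open condition. Both \<open>e_star\<close> and \<open>M\<close>
  are brought into this form.\<close>

lemma compactin_beta_superset:
  assumes "D \<subseteq> Pow S"
  shows "compactin (beta S) {q. ultrafilter_on S q \<and> D \<subseteq> q}"
proof -
  have "openin (beta S) (topspace (beta S) - {q. ultrafilter_on S q \<and> D \<subseteq> q})" (is "openin _ ?V")
  proof (subst openin_subopen, rule ballI)
    fix q assume "q \<in> ?V"
    then obtain A where A: "A \<in> D" "A \<subseteq> S" "A \<notin> q" and q: "ultrafilter_on S q"
      using assms by (auto simp: topspace_beta)
    let ?W = "{p. ultrafilter_on S p \<and> S - A \<in> p}"
    have "openin (beta S) ?W" by (rule openin_beta_basis) auto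
    moreover have "q \<in> ?W" "?W \<subseteq> ?V"
      using A q by (auto simp: topspace_beta ultrafilter_on_compl)
    ultimately show "\<exists>T. openin (beta S) T \<and> q \<in> T \<and> T \<subseteq> ?V" by blast
  qed
  then have "closedin (beta S) {q. ultrafilter_on S q \<and> D \<subseteq> q}"
    by (auto simp: closedin_def topspace_beta)
  then show ?thesis using closedin_compact_space compact_space_beta by blast
qed

text \<open>The push-forward of \<open>q\<close> along \<open>g\<close>; for \<open>g\<close>
  mapping \<open>S\<close> into \<open>R\<close> it is, as a function of \<open>q\<close>, the
  continuous extension of \<open>g\<close> from \<open>beta S\<close> to
  \<open>beta R\<close>.\<close>

definition map_uf :: "'b set \<Rightarrow> 'c set \<Rightarrow> ('b \<Rightarrow> 'c) \<Rightarrow> 'b set set \<Rightarrow> 'c set set" where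
  "map_uf S R g q = {A. A \<subseteq> R \<and> {x \<in> S. g x \<in> A} \<in> q}"

lemma ultrafilter_on_map_uf:
  assumes q: "ultrafilter_on S q" and g: "\<And>x. x \<in> S \<Longrightarrow> g x \<in> R"
  shows "ultrafilter_on R (map_uf S R g q)"
proof -
  have 1: "{x \<in> S. g x \<in> R} = S" "{x \<in> S. g x \<in> R - A} = S - {x \<in> S. g x \<in> A}"
    "{x \<in> S. g x \<in> A \<inter> B} = {x \<in> S. g x \<in> A} \<inter> {x \<in> S. g x \<in> B}" for A B
    using g by auto
  show ?thesis
    unfolding ultrafilter_on_def
  proof (intro conjI ballI allI impI)
    show "map_uf S R g q \<subseteq> Pow R" by (auto simp: map_uf_def)
    show "R \<in> map_uf S R g q" using q 1(1) by (simp add: map_uf_def ultrafilter_on_space)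
    show "{} \<notin> map_uf S R g q" using q by (simp add: map_uf_def ultrafilter_on_empty)
    show "A \<inter> B \<in> map_uf S R g q" if "A \<in> map_uf S R g q" "B \<in> map_uf S R g q" for A B
      using that q unfolding map_uf_def mem_Collect_eq 1(3) by (auto simp: ultrafilter_on_Int_iff)
    show "B \<in> map_uf S R g q" if "A \<in> map_uf S R g q" "A \<subseteq> B \<and> B \<subseteq> R" for A B
      using that q unfolding map_uf_def mem_Collect_eq
      by (auto elim!: ultrafilter_on_mono[rotated])
    show "A \<in> map_uf S R g q \<or> R - A \<in> map_uf S R g q" if "A \<subseteq> R" for A
      using that q unfolding map_uf_def mem_Collect_eq 1(2)
      by (auto simp: ultrafilter_on_compl)
  qed
qed

lemma map_uf_principal_uf:
  "x \<in> S \<Longrightarrow> map_uf S R g (principal_uf S x) = principal_uf R (g x)"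
  by (auto simp: map_uf_def principal_uf_def)

lemma continuous_map_beta:
  assumes "\<And>x. x \<in> topspace X \<Longrightarrow> ultrafilter_on S (h x)"
    and "\<And>A. A \<subseteq> S \<Longrightarrow> openin X {x \<in> topspace X. A \<in> h x}"
  shows "continuous_map X (beta S) h"
  unfolding beta_def
proof (rule continuous_on_generated_topo)
  fix U assume "U \<in> {{p. ultrafilter_on S p \<and> A \<in> p} | A. A \<subseteq> S}"
  then obtain A where A: "A \<subseteq> S" "U = {p. ultrafilter_on S p \<and> A \<in> p}" by blast
  then have "h -` U \<inter> topspace X = {x \<in> topspace X. A \<in> h x}" using assms(1) by auto
  then show "openin X (h -` U \<inter> topspace X)" using assms(2) A by simp
next
  show "h ` topspace X \<subseteq> \<Union>{{p. ultrafilter_on S p \<and> A \<in> p} | A. A \<subseteq> S}"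
    using assms(1) by (auto intro: ultrafilter_on_space)
qed

lemma continuous_map_map_uf:
  assumes "\<And>x. x \<in> S \<Longrightarrow> g x \<in> R"
  shows "continuous_map (beta S) (beta R) (map_uf S R g)"
proof (rule continuous_map_beta)
  fix A assume A: "A \<subseteq> R"
  have "{q \<in> topspace (beta S). A \<in> map_uf S R g q} = {q. ultrafilter_on S q \<and> {x \<in> S. g x \<in> A} \<in> q}"
    using A by (auto simp: topspace_beta map_uf_def)
  then show "openin (beta S) {q \<in> topspace (beta S). A \<in> map_uf S R g q}"
    by (simp add: openin_beta_basis)
qed (use assms in \<open>auto simp: topspace_beta intro: ultrafilter_on_map_uf\<close>)

text \<open>Uniqueness of the extension. If \<open>A \<in> h q\<close>, continuity gives some
  \<open>B \<in> q\<close> such that \<open>A\<close> lies in the image of every ultrafilter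
  containing \<open>B\<close>; the principal ones among these show that \<open>g\<close> maps
  \<open>B\<close> into \<open>A\<close>.\<close>

lemma continuous_map_beta_eq_map_uf:
  assumes h: "continuous_map (beta S) (beta R) h"
    and principal: "\<And>x. x \<in> S \<Longrightarrow> h (principal_uf S x) = principal_uf R (g x)"
    and g: "\<And>x. x \<in> S \<Longrightarrow> g x \<in> R" and q: "ultrafilter_on S q"
  shows "h q = map_uf S R g q"
proof (rule ultrafilter_on_subset_eq)
  show hq: "ultrafilter_on R (h q)"
    using continuous_map_image_subset_topspace[OF h] q by (auto simp: topspace_beta)
  show "ultrafilter_on R (map_uf S R g q)" using q g by (rule ultrafilter_on_map_uf)
  show "h q \<subseteq> map_uf S R g q"
  proof
    fix A assume A: "A \<in> h q"
    then have AR: "A \<subseteq> R" using hq ultrafilter_on_subset by blast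
    let ?V = "{r \<in> topspace (beta S). h r \<in> {p. ultrafilter_on R p \<and> A \<in> p}}"
    have V: "openin (beta S) ?V"
      using h openin_beta_basis[OF AR] by (rule openin_continuous_map_preimage)
    have "q \<in> ?V" using A hq q by (simp add: topspace_beta)
    then obtain B where B: "B \<in> q" "B \<subseteq> S" "{r. ultrafilter_on S r \<and> B \<in> r} \<subseteq> ?V"
      using openin_betaD[OF V] by blast
    have "g x \<in> A" if "x \<in> B" for x
    proof -
      have x: "x \<in> S" using that B by auto
      then have "principal_uf S x \<in> {r. ultrafilter_on S r \<and> B \<in> r}"
        using that B by (auto simp: ultrafilter_on_principal_uf) (simp add: principal_uf_def)
      then have "A \<in> h (principal_uf S x)" using B(3) by blast
      then show ?thesis using principal[OF x] by (simp add: principal_uf_def)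
    qed
    then have "B \<subseteq> {x \<in> S. g x \<in> A}" using B by auto
    then have "{x \<in> S. g x \<in> A} \<in> q"
      by (rule ultrafilter_on_mono[OF q B(1)]) auto
    then show "A \<in> map_uf S R g q" using AR by (simp add: map_uf_def)
  qed
qed

text \<open>Evaluates the definite description in \<open>beta_extension\<close>: a continuous map
  into the product is determined by its coordinates, to which the preceding uniqueness
  applies.\<close>

lemma beta_extension_principal_uf:
  assumes g: "\<And>i x. i \<in> I \<Longrightarrow> x \<in> S \<Longrightarrow> g i x \<in> R i"
  shows "beta_extension S (product_topology (\<lambda>i. beta (R i)) I) (\<lambda>x. \<lambda>i\<in>I. principal_uf (R i) (g i x))
    = (\<lambda>q\<in>topspace (beta S). \<lambda>i\<in>I. map_uf S (R i) (g i) q)" (is "_ = ?h")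
  unfolding beta_extension_def
proof (rule the_equality, intro conjI ballI)
  have "continuous_map (beta S) (product_topology (\<lambda>i. beta (R i)) I) (\<lambda>q. \<lambda>i\<in>I. map_uf S (R i) (g i) q)"
    unfolding continuous_map_componentwise by (auto intro!: continuous_map_map_uf g)
  then show "continuous_map (beta S) (product_topology (\<lambda>i. beta (R i)) I) ?h"
    by (rule continuous_map_eq) simp
  show "?h (principal_uf S x) = (\<lambda>i\<in>I. principal_uf (R i) (g i x))" if "x \<in> S" for x
    using that by (simp add: topspace_beta ultrafilter_on_principal_uf map_uf_principal_uf)
next
  fix h assume h: "h \<in> extensional (topspace (beta S)) \<and>
    continuous_map (beta S) (product_topology (\<lambda>i. beta (R i)) I) h \<and>
    (\<forall>x\<in>S. h (principal_uf S x) = (\<lambda>i\<in>I. principal_uf (R i) (g i x)))"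
  then have ext: "h ` topspace (beta S) \<subseteq> extensional I"
    and cont: "\<And>i. i \<in> I \<Longrightarrow> continuous_map (beta S) (beta (R i)) (\<lambda>q. h q i)"
    unfolding continuous_map_componentwise by auto
  show "h = ?h"
  proof (rule extensionalityI)
    fix q assume q: "q \<in> topspace (beta S)"
    have "h q = (\<lambda>i\<in>I. map_uf S (R i) (g i) q)"
    proof (rule extensionalityI)
      fix i assume i: "i \<in> I"
      have "h q i = map_uf S (R i) (g i) q"
        by (rule continuous_map_beta_eq_map_uf[OF cont[OF i]])
          (use i g h q in \<open>auto simp: topspace_beta\<close>)
      then show "h q i = (\<lambda>i\<in>I. map_uf S (R i) (g i) q) i" using i by simp
    qed (use ext q in auto)
    then show "h q = ?h q" using q by simp
  qed (use h in auto)
qed auto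

section \<open>The semigroup of ultrafilters\<close>

lemma ultrafilter_on_beta_op:
  assumes p: "ultrafilter_on S p" and q: "ultrafilter_on S q"
    and f: "\<And>x y. x \<in> S \<Longrightarrow> y \<in> S \<Longrightarrow> f x y \<in> S"
  shows "ultrafilter_on S (beta_op S f p q)"
proof -
  \<comment> \<open>Since \<open>q\<close> is an ultrafilter, \<open>N\<close> commutes with
    intersections and complements; the sum is the preimage of the ultrafilter \<open>p\<close> under
    \<open>N\<close>, so the axioms transfer.\<close>
  define N where "N A = {x \<in> S. {y \<in> S. f x y \<in> A} \<in> q}" for A
  have N: "A \<in> beta_op S f p q \<longleftrightarrow> A \<subseteq> S \<and> N A \<in> p" for A
    by (simp add: beta_op_def N_def)
  have sub: "N A \<subseteq> S" for A by (auto simp: N_def)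
  have "{y \<in> S. f x y \<in> S} = S" if "x \<in> S" for x using that f by auto
  then have NS: "N S = S" using q by (auto simp: N_def ultrafilter_on_space)
  have NE: "N {} = {}" using q by (simp add: N_def ultrafilter_on_empty)
  have "{y \<in> S. f x y \<in> A \<inter> B} = {y \<in> S. f x y \<in> A} \<inter> {y \<in> S. f x y \<in> B}" for x A B by auto
  then have NI: "N (A \<inter> B) = N A \<inter> N B" for A B
    using q by (auto simp: N_def ultrafilter_on_Int_iff)
  have "{y \<in> S. f x y \<in> S - A} = S - {y \<in> S. f x y \<in> A}" if "x \<in> S" for x A
    using that f by auto
  then have NC: "N (S - A) = S - N A" for A
    using q by (auto simp: N_def ultrafilter_on_compl)
  have NM: "N A \<subseteq> N B" if "A \<subseteq> B" for A B
    using NI[of A B] that by (metis inf.absorb1 inf.cobounded2)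
  show ?thesis
    unfolding ultrafilter_on_def N
  proof (intro conjI ballI allI impI)
    show "beta_op S f p q \<subseteq> Pow S" by (auto simp: beta_op_def)
    fix A B assume "A \<in> beta_op S f p q"
    then have A: "A \<subseteq> S" "N A \<in> p" by (auto simp: N)
    then show "A \<inter> B \<subseteq> S" by auto
    show "N (A \<inter> B) \<in> p" if "B \<in> beta_op S f p q"
      using A that p by (simp add: N NI ultrafilter_on_Int)
    show "B \<subseteq> S" "N B \<in> p" if "A \<subseteq> B \<and> B \<subseteq> S"
      using A that ultrafilter_on_mono[OF p _ NM sub] by auto
  qed (use p sub in \<open>auto simp: NS NE NC ultrafilter_on_compl ultrafilter_on_space ultrafilter_on_empty\<close>)
qed

text \<open>Both sides unfold to the same threefold iterated condition on \<open>x + y + z\<close>.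
  It is stated for arbitrary families, so it rewrites without side conditions.\<close>

lemma beta_op_assoc:
  assumes f: "semigroup_on S f"
  shows "beta_op S f (beta_op S f p q) r = beta_op S f p (beta_op S f q r)"
proof -
  have "{y \<in> S. f x y \<in> {w \<in> S. {z \<in> S. f w z \<in> A} \<in> r}} = {y \<in> S. {z \<in> S. f y z \<in> {w \<in> S. f x w \<in> A}} \<in> r}"
    if "x \<in> S" for x A
  proof -
    have "{z \<in> S. f (f x y) z \<in> A} = {z \<in> S. f y z \<in> {w \<in> S. f x w \<in> A}}" "f x y \<in> S" if "y \<in> S" for y
      using \<open>x \<in> S\<close> that f by (auto simp: semigroup_on_def)
    then show ?thesis by auto
  qed
  then show ?thesis
    by (auto simp: beta_op_def cong: conj_cong)
qed

lemma continuous_map_beta_op: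
  assumes "ultrafilter_on S q" "\<And>x y. x \<in> S \<Longrightarrow> y \<in> S \<Longrightarrow> f x y \<in> S"
  shows "continuous_map (beta S) (beta S) (\<lambda>p. beta_op S f p q)"
proof (rule continuous_map_beta)
  fix A assume A: "A \<subseteq> S"
  have "{p \<in> topspace (beta S). A \<in> beta_op S f p q} =
      {p. ultrafilter_on S p \<and> {x \<in> S. {y \<in> S. f x y \<in> A} \<in> q} \<in> p}"
    using A by (auto simp: topspace_beta beta_op_def)
  then show "openin (beta S) {p \<in> topspace (beta S). A \<in> beta_op S f p q}"
    by (simp add: openin_beta_basis)
qed (use assms in \<open>auto simp: topspace_beta intro: ultrafilter_on_beta_op\<close>)

lemma compact_right_topological_semigroup_beta:
  assumes f: "semigroup_on S f" and C: "compactin (beta S) C" "C \<noteq> {}"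
    and op: "\<And>p q. p \<in> C \<Longrightarrow> q \<in> C \<Longrightarrow> beta_op S f p q \<in> C"
  shows "compact_right_topological_semigroup (beta S) C (beta_op S f)"
proof
  have uf: "ultrafilter_on S q" if "q \<in> C" for q
    using compactin_subset_topspace[OF C(1)] that by (auto simp: topspace_beta)
  show "semigroup_on C (beta_op S f)"
    using C op beta_op_assoc[OF f] by (auto simp: semigroup_on_def)
  show "continuous_map (subtopology (beta S) C) (beta S) (\<lambda>p. beta_op S f p q)" if "q \<in> C" for q
    using f by (intro continuous_map_from_subtopology continuous_map_beta_op uf that)
      (auto simp: semigroup_on_def)
qed (use C Hausdorff_space_beta in auto)

text \<open>Translation by \<open>x\<close> followed by \<open>g\<close> is \<open>g\<close>
  followed by translation by \<open>g x\<close>, so the two iterated preimages agree. This makes the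
  coordinate maps homomorphisms.\<close>

lemma map_uf_beta_op:
  assumes p: "ultrafilter_on S p" and f: "\<And>x y. x \<in> S \<Longrightarrow> y \<in> S \<Longrightarrow> f x y \<in> S"
    and g: "\<And>x. x \<in> S \<Longrightarrow> g x \<in> R"
    and hom: "\<And>x y. x \<in> S \<Longrightarrow> y \<in> S \<Longrightarrow> g (f x y) = h (g x) (g y)"
  shows "map_uf S R g (beta_op S f p q) = beta_op R h (map_uf S R g p) (map_uf S R g q)"
proof -
  have eq: "{x \<in> S. {y \<in> S. f x y \<in> {x \<in> S. g x \<in> A}} \<in> q} =
      {x \<in> S. g x \<in> {a \<in> R. {b \<in> R. h a b \<in> A} \<in> map_uf S R g q}}" for A
  proof -
    have "{y \<in> S. f x y \<in> {x \<in> S. g x \<in> A}} = {y \<in> S. g y \<in> {b \<in> R. h (g x) b \<in> A}}" if "x \<in> S" for x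
      using that f g hom by auto
    then show ?thesis using g by (auto simp: map_uf_def)
  qed
  show ?thesis
  proof (rule set_eqI)
    fix A
    let ?A = "{x \<in> S. g x \<in> A}" and ?B = "{a \<in> R. {b \<in> R. h a b \<in> A} \<in> map_uf S R g q}"
    have "A \<in> map_uf S R g (beta_op S f p q) \<longleftrightarrow> A \<subseteq> R \<and> {x \<in> S. {y \<in> S. f x y \<in> ?A} \<in> q} \<in> p"
      unfolding map_uf_def beta_op_def by blast
    also have "\<dots> \<longleftrightarrow> A \<subseteq> R \<and> {x \<in> S. g x \<in> ?B} \<in> p" unfolding eq ..
    also have "\<dots> \<longleftrightarrow> A \<subseteq> R \<and> ?B \<in> map_uf S R g p" unfolding map_uf_def[of S R g p] by blast
    also have "\<dots> \<longleftrightarrow> A \<in> beta_op R h (map_uf S R g p) (map_uf S R g q)"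
      unfolding beta_op_def by blast
    finally show "A \<in> map_uf S R g (beta_op S f p q) \<longleftrightarrow>
      A \<in> beta_op R h (map_uf S R g p) (map_uf S R g q)" .
  qed
qed

section \<open>Ultrafilters near an idempotent\<close>

lemma mem_e_star_iff:
  "q \<in> e_star T e S \<longleftrightarrow> ultrafilter_on S q \<and> (\<forall>V. openin T V \<and> e \<in> V \<longrightarrow> V \<inter> S \<in> q)"
proof safe
  assume q: "q \<in> e_star T e S"
  then show "ultrafilter_on S q" by (simp add: e_star_def topspace_beta)
  fix V assume "openin T V" "e \<in> V"
  then have "V \<in> neighborhoods T e" by (auto simp: neighborhoods_def openin_subset)
  then show "V \<inter> S \<in> q" using q by (simp add: e_star_def)
next
  assume q: "ultrafilter_on S q" "\<forall>V. openin T V \<and> e \<in> V \<longrightarrow> V \<inter> S \<in> q"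
  have "U \<inter> S \<in> q" if U: "U \<in> neighborhoods T e" for U
  proof -
    obtain V where "openin T V" "e \<in> V" "V \<subseteq> U" using U by (auto simp: neighborhoods_def)
    then show ?thesis using q by (auto intro: ultrafilter_on_mono[of S q "V \<inter> S"])
  qed
  then show "q \<in> e_star T e S" using q by (simp add: e_star_def topspace_beta)
qed

lemma e_star_eq_superset:
  "e_star T e S = {q. ultrafilter_on S q \<and> (\<lambda>V. V \<inter> S) ` {V. openin T V \<and> e \<in> V} \<subseteq> q}"
  by (simp add: set_eq_iff mem_e_star_iff image_subset_iff)

lemma compactin_e_star: "compactin (beta S) (e_star T e S)"
  unfolding e_star_eq_superset by (rule compactin_beta_superset) auto

text \<open>Since \<open>e\<close> is in the closure, the traces on \<open>S\<close> of its open
  neighborhoods have the finite intersection property.\<close>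

lemma e_star_nonempty:
  assumes e: "e \<in> T closure_of S"
  shows "e_star T e S \<noteq> {}"
proof -
  obtain q where "ultrafilter_on S q" "(\<lambda>V. V \<inter> S) ` {V. openin T V \<and> e \<in> V} \<subseteq> q"
  proof (rule ultrafilter_exists)
    fix \<F> assume F: "finite \<F>" "\<F> \<subseteq> (\<lambda>V. V \<inter> S) ` {V. openin T V \<and> e \<in> V}"
    then obtain \<G> where G: "finite \<G>" "\<G> \<subseteq> {V. openin T V \<and> e \<in> V}" "\<F> = (\<lambda>V. V \<inter> S) ` \<G>"
      by (meson finite_subset_image)
    \<comment> \<open>Inserting \<open>topspace T\<close> keeps the intersection open when
      \<open>\<G>\<close> is empty.\<close>
    have "openin T (\<Inter>(insert (topspace T) \<G>))"
      using G by (intro openin_Inter) auto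
    moreover have "e \<in> \<Inter>(insert (topspace T) \<G>)"
      using G e by (auto simp: in_closure_of)
    ultimately obtain y where "y \<in> S" "y \<in> \<Inter>(insert (topspace T) \<G>)"
      using e unfolding in_closure_of by blast
    then show "S \<inter> \<Inter>\<F> \<noteq> {}" using G by auto
  qed auto
  then show ?thesis unfolding e_star_eq_superset by blast
qed

text \<open>Separate continuity is enough: as \<open>e + e = e\<close>, the points \<open>x\<close>
  with \<open>x + e \<in> V\<close> form a neighborhood of \<open>e\<close>, and for each such
  \<open>x\<close> so do the points \<open>y\<close> with \<open>x + y \<in> V\<close>.\<close>

lemma beta_op_in_e_star:
  assumes S: "S \<subseteq> topspace T" "\<And>x y. x \<in> S \<Longrightarrow> y \<in> S \<Longrightarrow> f x y \<in> S"
    and e: "e \<in> topspace T" "f e e = e"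
    and left: "\<And>a. a \<in> topspace T \<Longrightarrow> continuous_map T T (\<lambda>x. f a x)"
    and right: "\<And>a. a \<in> topspace T \<Longrightarrow> continuous_map T T (\<lambda>x. f x a)"
    and pq: "p \<in> e_star T e S" "q \<in> e_star T e S"
  shows "beta_op S f p q \<in> e_star T e S"
proof -
  have p: "ultrafilter_on S p" "\<And>V. openin T V \<Longrightarrow> e \<in> V \<Longrightarrow> V \<inter> S \<in> p"
    and q: "ultrafilter_on S q" "\<And>V. openin T V \<Longrightarrow> e \<in> V \<Longrightarrow> V \<inter> S \<in> q"
    using pq by (auto simp: mem_e_star_iff)
  have "V \<inter> S \<in> beta_op S f p q" if V: "openin T V" "e \<in> V" for V
  proof -
    let ?W = "{x \<in> topspace T. f x e \<in> V}"
    have W: "openin T ?W" "e \<in> ?W"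
      using openin_continuous_map_preimage[OF right[OF e(1)] V(1)] V e by auto
    have "{y \<in> S. f x y \<in> V \<inter> S} \<in> q" if x: "x \<in> ?W \<inter> S" for x
    proof -
      have "openin T {y \<in> topspace T. f x y \<in> V}"
        using openin_continuous_map_preimage[OF left V(1)] x by auto
      moreover have "e \<in> {y \<in> topspace T. f x y \<in> V}" using x e by auto
      ultimately have "{y \<in> topspace T. f x y \<in> V} \<inter> S \<in> q" by (rule q(2))
      moreover have "{y \<in> topspace T. f x y \<in> V} \<inter> S = {y \<in> S. f x y \<in> V \<inter> S}"
        using S x by auto
      ultimately show ?thesis by simp
    qed
    then have "?W \<inter> S \<subseteq> {x \<in> S. {y \<in> S. f x y \<in> V \<inter> S} \<in> q}" by auto
    then have "{x \<in> S. {y \<in> S. f x y \<in> V \<inter> S} \<in> q} \<in> p"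
      by (rule ultrafilter_on_mono[OF p(1) p(2)[OF W]]) auto
    then show ?thesis by (simp add: beta_op_def)
  qed
  moreover have "ultrafilter_on S (beta_op S f p q)"
    using p(1) q(1) S(2) by (rule ultrafilter_on_beta_op)
  ultimately show ?thesis by (simp add: mem_e_star_iff)
qed

section \<open>Box products\<close>

lemma topspace_box_topology: "topspace (box_topology T I) = (\<Pi>\<^sub>E i\<in>I. topspace (T i))"
proof
  show "topspace (box_topology T I) \<subseteq> (\<Pi>\<^sub>E i\<in>I. topspace (T i))"
    unfolding box_topology_def topology_generated_by_topspace
    by (auto simp: PiE_def Pi_def dest!: openin_subset)
  show "(\<Pi>\<^sub>E i\<in>I. topspace (T i)) \<subseteq> topspace (box_topology T I)"
    unfolding box_topology_def topology_generated_by_topspace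
    by (intro Union_upper CollectI exI[of _ "\<lambda>i. topspace (T i)"]) auto
qed

lemma openin_box: "(\<And>i. i \<in> I \<Longrightarrow> openin (T i) (U i)) \<Longrightarrow> openin (box_topology T I) (\<Pi>\<^sub>E i\<in>I. U i)"
  unfolding box_topology_def by (rule topology_generated_by_Basis) blast

lemma openin_box_topologyD:
  assumes "openin (box_topology T I) V" "x \<in> V"
  obtains U where "\<And>i. i \<in> I \<Longrightarrow> openin (T i) (U i)" "x \<in> (\<Pi>\<^sub>E i\<in>I. U i)" "(\<Pi>\<^sub>E i\<in>I. U i) \<subseteq> V"
proof -
  obtain B where "B \<in> {(\<Pi>\<^sub>E i\<in>I. U i) | U. \<forall>i\<in>I. openin (T i) (U i)}" "x \<in> B" "B \<subseteq> V"
  proof (rule openin_generated_intersection_stable[OF assms[unfolded box_topology_def]])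
    fix A B assume "A \<in> {(\<Pi>\<^sub>E i\<in>I. U i) | U. \<forall>i\<in>I. openin (T i) (U i)}"
      "B \<in> {(\<Pi>\<^sub>E i\<in>I. U i) | U. \<forall>i\<in>I. openin (T i) (U i)}"
    then obtain U W where "\<forall>i\<in>I. openin (T i) (U i)" "A = (\<Pi>\<^sub>E i\<in>I. U i)"
      "\<forall>i\<in>I. openin (T i) (W i)" "B = (\<Pi>\<^sub>E i\<in>I. W i)" by blast
    then show "A \<inter> B \<in> {(\<Pi>\<^sub>E i\<in>I. U i) | U. \<forall>i\<in>I. openin (T i) (U i)}"
      by (auto simp: PiE_Int)
  qed blast
  then show ?thesis using that by blast
qed

text \<open>The preimage of a box is the box of the preimages. Applied to translations, this gives
  separate continuity in the box product.\<close>

lemma continuous_map_box_topology: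
  assumes "\<And>i. i \<in> I \<Longrightarrow> continuous_map (T i) (T' i) (h i)"
  shows "continuous_map (box_topology T I) (box_topology T' I) (\<lambda>x. \<lambda>i\<in>I. h i (x i))"
  unfolding box_topology_def[of T']
proof (rule continuous_on_generated_topo)
  fix B assume "B \<in> {(\<Pi>\<^sub>E i\<in>I. U i) | U. \<forall>i\<in>I. openin (T' i) (U i)}"
  then obtain U where U: "\<And>i. i \<in> I \<Longrightarrow> openin (T' i) (U i)" "B = (\<Pi>\<^sub>E i\<in>I. U i)" by blast
  have "(\<lambda>x. \<lambda>i\<in>I. h i (x i)) -` B \<inter> topspace (box_topology T I) =
      (\<Pi>\<^sub>E i\<in>I. {x \<in> topspace (T i). h i x \<in> U i})"
    unfolding U(2) topspace_box_topology by (auto simp: PiE_iff)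
  then show "openin (box_topology T I) ((\<lambda>x. \<lambda>i\<in>I. h i (x i)) -` B \<inter> topspace (box_topology T I))"
    using U assms by (auto intro!: openin_box openin_continuous_map_preimage)
next
  have "(\<lambda>x. \<lambda>i\<in>I. h i (x i)) ` topspace (box_topology T I) \<subseteq> topspace (box_topology T' I)"
    using continuous_map_image_subset_topspace[OF assms]
    unfolding topspace_box_topology by (auto simp: PiE_iff image_subset_iff)
  then show "(\<lambda>x. \<lambda>i\<in>I. h i (x i)) ` topspace (box_topology T I) \<subseteq>
      \<Union>{(\<Pi>\<^sub>E i\<in>I. U i) | U. \<forall>i\<in>I. openin (T' i) (U i)}"
    by (simp only: box_topology_def topology_generated_by_topspace)
qed

text \<open>Boxes with one side in each \<open>p i\<close> form a filter base, even with infinitely many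
  proper sides.\<close>

lemma box_ultrafilter_exists:
  assumes p: "\<And>i. i \<in> I \<Longrightarrow> ultrafilter_on (S i) (p i)"
  obtains q where "ultrafilter_on (\<Pi>\<^sub>E i\<in>I. S i) q"
    "\<And>B. (\<And>i. i \<in> I \<Longrightarrow> B i \<in> p i) \<Longrightarrow> (\<Pi>\<^sub>E i\<in>I. B i) \<in> q"
proof -
  let ?S = "\<Pi>\<^sub>E i\<in>I. S i"
  let ?D = "{(\<Pi>\<^sub>E i\<in>I. B i) | B. \<forall>i\<in>I. B i \<in> p i}"
  have sub: "?D \<subseteq> Pow ?S"
    using p by (auto dest!: ultrafilter_on_subset[rotated] simp: PiE_iff)
  obtain q where q: "ultrafilter_on ?S q" "?D \<subseteq> q"
  proof (rule ultrafilter_exists[OF sub])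
    fix \<F> assume "finite \<F>" "\<F> \<subseteq> ?D"
    \<comment> \<open>Induction needs more than nonemptiness: a finite intersection contains a box
      with sides in the \<open>p i\<close>, obtained by intersecting coordinatewise. The empty
      family gives the box with sides \<open>S i\<close>.\<close>
    then have "\<exists>B. (\<forall>i\<in>I. B i \<in> p i) \<and> (\<Pi>\<^sub>E i\<in>I. B i) \<subseteq> ?S \<inter> \<Inter>\<F>"
    proof (induction rule: finite_induct)
      case empty
      then show ?case using p by (intro exI[of _ S]) (auto intro: ultrafilter_on_space)
    next
      case (insert A \<F>)
      then obtain B where B: "\<forall>i\<in>I. B i \<in> p i" "(\<Pi>\<^sub>E i\<in>I. B i) \<subseteq> ?S \<inter> \<Inter>\<F>" by auto
      obtain C where C: "\<forall>i\<in>I. C i \<in> p i" "A = (\<Pi>\<^sub>E i\<in>I. C i)" using insert by auto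
      have "(\<Pi>\<^sub>E i\<in>I. B i \<inter> C i) \<subseteq> ?S \<inter> \<Inter>(insert A \<F>)"
        using B(2) unfolding C(2) PiE_Int[symmetric] by blast
      then show ?case
        using B(1) C(1) p by (intro exI[of _ "\<lambda>i. B i \<inter> C i"]) (auto intro: ultrafilter_on_Int)
    qed
    then obtain B where B: "\<forall>i\<in>I. B i \<in> p i" "(\<Pi>\<^sub>E i\<in>I. B i) \<subseteq> ?S \<inter> \<Inter>\<F>"
      by (elim exE conjE) (rule that)
    then have "\<forall>i\<in>I. B i \<noteq> {}" using p ultrafilter_on_empty by metis
    then have "(\<Pi>\<^sub>E i\<in>I. B i) \<noteq> {}" by (simp add: PiE_eq_empty_iff)
    with B(2) show "?S \<inter> \<Inter>\<F> \<noteq> {}" by (metis subset_empty)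
  qed
  show ?thesis
  proof (rule that[OF q(1)])
    show "(\<Pi>\<^sub>E i\<in>I. B i) \<in> q" if "\<And>i. i \<in> I \<Longrightarrow> B i \<in> p i" for B
      using that by (intro subsetD[OF q(2)] CollectI exI[of _ B]) simp
  qed
qed

text \<open>Restricting the single coordinate \<open>i\<close> to an open \<open>V\<close> around
  \<open>e i\<close> gives a box that is a neighborhood of the product point, so \<open>q\<close>
  contains its trace.\<close>

lemma map_uf_in_e_star:
  assumes i: "i \<in> I" and e: "\<And>j. j \<in> I \<Longrightarrow> e j \<in> topspace (T j)"
    and q: "q \<in> e_star (box_topology T I) (\<lambda>i\<in>I. e i) (\<Pi>\<^sub>E i\<in>I. S i)"
  shows "map_uf (\<Pi>\<^sub>E i\<in>I. S i) (S i) (\<lambda>x. x i) q \<in> e_star (T i) (e i) (S i)"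
proof -
  let ?S = "\<Pi>\<^sub>E i\<in>I. S i"
  have uf: "ultrafilter_on ?S q" using q by (simp add: mem_e_star_iff)
  have "{x \<in> ?S. x i \<in> V \<inter> S i} \<in> q" if V: "openin (T i) V" "e i \<in> V" for V
  proof -
    let ?B = "\<Pi>\<^sub>E j\<in>I. if j = i then V else topspace (T j)"
    have "openin (box_topology T I) ?B" using V by (intro openin_box) auto
    moreover have "(\<lambda>i\<in>I. e i) \<in> ?B" using V e by auto
    ultimately have "?B \<inter> ?S \<in> q" using q by (simp add: mem_e_star_iff)
    moreover have "?B \<inter> ?S \<subseteq> {x \<in> ?S. x i \<in> V \<inter> S i}"
    proof
      fix x assume x: "x \<in> ?B \<inter> ?S"
      have "x i \<in> V" using PiE_mem[OF IntD1[OF x] i] by simp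
      moreover have "x i \<in> S i" using PiE_mem[OF IntD2[OF x] i] .
      ultimately show "x \<in> {x \<in> ?S. x i \<in> V \<inter> S i}" using x by simp
    qed
    ultimately show ?thesis by (rule ultrafilter_on_mono[OF uf]) auto
  qed
  moreover have "ultrafilter_on (S i) (map_uf ?S (S i) (\<lambda>x. x i) q)"
    using uf i by (intro ultrafilter_on_map_uf) auto
  ultimately show ?thesis by (auto simp: mem_e_star_iff map_uf_def)
qed

section \<open>Compactness of \<open>M\<close> and comparison of the two smallest ideals\<close>

theorem theorem2p12:
  fixes I :: "'i set"
    and T :: "'i \<Rightarrow> 'a topology"
    and f :: "'i \<Rightarrow> 'a \<Rightarrow> 'a \<Rightarrow> 'a"
    and S :: "'i \<Rightarrow> 'a set"
    and e :: "'i \<Rightarrow> 'a"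
    and p :: "'i \<Rightarrow> 'a set set"
    and TT :: "('i \<Rightarrow> 'a) topology"
    and ff :: "('i \<Rightarrow> 'a) \<Rightarrow> ('i \<Rightarrow> 'a) \<Rightarrow> ('i \<Rightarrow> 'a)"
    and SS :: "('i \<Rightarrow> 'a) set"
    and ee :: "'i \<Rightarrow> 'a"
    and pp :: "'i \<Rightarrow> 'a set set"
    and iota :: "('i \<Rightarrow> 'a) \<Rightarrow> ('i \<Rightarrow> 'a set set)"
    and iota_ext :: "('i \<Rightarrow> 'a) set set \<Rightarrow> ('i \<Rightarrow> 'a set set)"
    and M :: "('i \<Rightarrow> 'a) set set set"
  assumes "\<And>i. i \<in> I \<Longrightarrow> semitopological_semigroup (T i) (f i)"
    and "\<And>i. i \<in> I \<Longrightarrow> near_subsemigroup (T i) (f i) (e i) (S i)"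
    and "\<And>i. i \<in> I \<Longrightarrow> p i \<in> smallest_ideal (e_star (T i) (e i) (S i)) (beta_op (S i) (f i))"
    and "\<And>i. i \<in> I \<Longrightarrow> beta_op (S i) (f i) (p i) (p i) = p i"
  defines "TT \<equiv> box_topology T I"
    and "ff \<equiv> product_op f I"
    and "SS \<equiv> \<Pi>\<^sub>E i\<in>I. S i"
    and "ee \<equiv> \<lambda>i\<in>I. e i"
    and "pp \<equiv> \<lambda>i\<in>I. p i"
    and "iota \<equiv> \<lambda>x. \<lambda>i\<in>I. principal_uf (S i) (x i)"
    and "iota_ext \<equiv> beta_extension SS (product_topology (\<lambda>i. beta (S i)) I) iota"
    and "M \<equiv> {q \<in> topspace (beta SS). iota_ext q = pp} \<inter> e_star TT ee SS"
  shows "compactin (beta SS) M \<and>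
         subsemigroup_of M (e_star TT ee SS) (beta_op SS ff) \<and>
         smallest_ideal M (beta_op SS ff) \<subseteq> smallest_ideal (e_star TT ee SS) (beta_op SS ff)"
proof -
  note semitop = assms(1) and near = assms(2) and minimal = assms(3) and idem = assms(4)
  let ?E = "e_star TT ee SS" and ?op = "beta_op SS ff"
  let ?Ei = "\<lambda>i. e_star (T i) (e i) (S i)" and ?opi = "\<lambda>i. beta_op (S i) (f i)"
  let ?\<pi> = "\<lambda>i. map_uf SS (S i) (\<lambda>x. x i)"
  have S: "S i \<subseteq> topspace (T i)" "S i \<noteq> {}" "\<And>x y. x \<in> S i \<Longrightarrow> y \<in> S i \<Longrightarrow> f i x y \<in> S i"
    and e: "e i \<in> topspace (T i)" "f i (e i) (e i) = e i" "e i \<in> T i closure_of S i"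
    if "i \<in> I" for i
    using near[OF that] by (auto simp: near_subsemigroup_def subsemigroup_of_def)
  have left: "continuous_map (T i) (T i) (\<lambda>x. f i a x)"
    and right: "continuous_map (T i) (T i) (\<lambda>x. f i x a)"
    if "i \<in> I" "a \<in> topspace (T i)" for i a
    using semitop[OF that(1)] that(2) by (auto simp: semitopological_semigroup_def)
  have sg: "semigroup_on (S i) (f i)" if "i \<in> I" for i
    using semitop[OF that] S[OF that]
    by (auto simp: semitopological_semigroup_def semigroup_on_def subset_iff)
  have Ei: "compact_right_topological_semigroup (beta (S i)) (?Ei i) (?opi i)" if i: "i \<in> I" for i
    by (intro compact_right_topological_semigroup_beta sg compactin_e_star e_star_nonempty
        beta_op_in_e_star left right S e i)
  \<comment> \<open>The semigroup structure just established makes \<open>smallest_ideal\<close> a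
    genuine ideal, which places \<open>p i\<close> in \<open>e_star\<close>.\<close>
  have p: "p i \<in> ?Ei i" if "i \<in> I" for i
    using minimal[OF that] compact_right_topological_semigroup.smallest_ideal_subset[OF Ei[OF that]]
    by blast
  then have pu: "ultrafilter_on (S i) (p i)" if "i \<in> I" for i
    using that by (simp add: mem_e_star_iff)

  have SS: "SS \<subseteq> topspace TT" "\<And>x y. x \<in> SS \<Longrightarrow> y \<in> SS \<Longrightarrow> ff x y \<in> SS"
    using S by (auto simp: SS_def TT_def topspace_box_topology ff_def product_op_def PiE_iff subset_iff)
  have SSne: "SS \<noteq> {}" using S(2) by (simp add: SS_def PiE_eq_empty_iff)
  have sgSS: "semigroup_on SS ff"
    unfolding semigroup_on_def
  proof (intro conjI ballI)
    fix x y z assume "x \<in> SS" "y \<in> SS" "z \<in> SS"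
    then have "f i (f i (x i) (y i)) (z i) = f i (x i) (f i (y i) (z i))" if "i \<in> I" for i
      using sg[OF that] that by (auto simp: SS_def semigroup_on_def PiE_iff)
    then show "ff (ff x y) z = ff x (ff y z)" by (auto simp: ff_def product_op_def)
  qed (use SS SSne in auto)
  have ee: "ee \<in> topspace TT" "ff ee ee = ee"
    using e by (auto simp: ee_def TT_def topspace_box_topology ff_def product_op_def)
  have leftTT: "continuous_map TT TT (\<lambda>x. ff a x)" and rightTT: "continuous_map TT TT (\<lambda>x. ff x a)"
    if "a \<in> topspace TT" for a
    using that left right unfolding TT_def ff_def product_op_def topspace_box_topology
    by (auto intro!: continuous_map_box_topology simp: PiE_iff)
  have Eop: "?op q r \<in> ?E" if "q \<in> ?E" "r \<in> ?E" for q r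
    using SS ee leftTT rightTT that by (rule beta_op_in_e_star)

  have \<pi>u: "ultrafilter_on (S i) (?\<pi> i q)" if "i \<in> I" "ultrafilter_on SS q" for i q
    using that by (intro ultrafilter_on_map_uf) (auto simp: SS_def)
  have \<pi>op: "?\<pi> i (?op q r) = ?opi i (?\<pi> i q) (?\<pi> i r)"
    if "i \<in> I" "ultrafilter_on SS q" for i q r
    using that SS by (intro map_uf_beta_op) (auto simp: SS_def ff_def product_op_def)
  have iota_ext: "iota_ext = (\<lambda>q\<in>topspace (beta SS). \<lambda>i\<in>I. ?\<pi> i q)"
    unfolding iota_ext_def iota_def by (rule beta_extension_principal_uf) (auto simp: SS_def)
  have "iota_ext q = pp \<longleftrightarrow> (\<forall>i\<in>I. ?\<pi> i q = p i)" if "ultrafilter_on SS q" for q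
    using that by (auto simp: iota_ext topspace_beta pp_def fun_eq_iff restrict_def)
  then have M: "q \<in> M \<longleftrightarrow> q \<in> ?E \<and> (\<forall>i\<in>I. ?\<pi> i q = p i)" for q
    by (auto simp: M_def topspace_beta mem_e_star_iff)
  \<comment> \<open>By maximality the equation says only that \<open>q\<close> contains certain
    sets. In this form it can be used both for compactness and for the construction of a point of
    \<open>M\<close>.\<close>
  have \<pi>eq: "?\<pi> i q = p i \<longleftrightarrow> (\<forall>A\<in>p i. {x \<in> SS. x i \<in> A} \<in> q)"
    if i: "i \<in> I" and q: "ultrafilter_on SS q" for i q
  proof -
    have "?\<pi> i q = p i \<longleftrightarrow> p i \<subseteq> ?\<pi> i q"
      using ultrafilter_on_subset_eq[OF pu[OF i] \<pi>u[OF i q]] by auto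
    then show ?thesis
      using ultrafilter_on_subset[OF pu[OF i]] by (auto simp: map_uf_def)
  qed

  have Mcompact: "compactin (beta SS) M"
  proof -
    \<comment> \<open>Collects the sets prescribed by the coordinates \<open>p i\<close> and those
      prescribed by nearness to \<open>ee\<close>.\<close>
    define D where "D = (\<Union>i\<in>I. (\<lambda>A. {x \<in> SS. x i \<in> A}) ` p i) \<union>
      (\<lambda>V. V \<inter> SS) ` {V. openin TT V \<and> ee \<in> V}"
    have "M = {q. ultrafilter_on SS q \<and> D \<subseteq> q}"
    proof (rule set_eqI)
      fix q
      show "q \<in> M \<longleftrightarrow> q \<in> {q. ultrafilter_on SS q \<and> D \<subseteq> q}"
      proof (cases "ultrafilter_on SS q")
        case True
        then show ?thesis
          by (simp add: M \<pi>eq mem_e_star_iff D_def image_subset_iff UN_subset_iff) blast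
      qed (simp add: M mem_e_star_iff)
    qed
    moreover have "D \<subseteq> Pow SS" by (auto simp: D_def)
    ultimately show ?thesis using compactin_beta_superset by simp
  qed
  have Mne: "M \<noteq> {}"
  proof -
    obtain q where q: "ultrafilter_on SS q"
      and box: "\<And>B. (\<And>i. i \<in> I \<Longrightarrow> B i \<in> p i) \<Longrightarrow> (\<Pi>\<^sub>E i\<in>I. B i) \<in> q"
      using box_ultrafilter_exists[of I S p, folded SS_def] pu by blast
    have "{x \<in> SS. x i \<in> A} \<in> q" if "i \<in> I" "A \<in> p i" for i A
    proof -
      have "(\<Pi>\<^sub>E j\<in>I. if j = i then A else S j) \<in> q"
        using that pu by (intro box) (auto intro: ultrafilter_on_space)
      moreover have "A \<subseteq> S i" using pu that ultrafilter_on_subset by blast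
      then have "(\<Pi>\<^sub>E j\<in>I. if j = i then A else S j) \<subseteq> {x \<in> SS. x i \<in> A}"
        using that(1) by (fastforce simp: SS_def PiE_iff split: if_splits)
      ultimately show ?thesis by (rule ultrafilter_on_mono[OF q]) auto
    qed
    moreover have "V \<inter> SS \<in> q" if V: "openin TT V" "ee \<in> V" for V
    proof -
      obtain U where U: "\<And>i. i \<in> I \<Longrightarrow> openin (T i) (U i)" "ee \<in> (\<Pi>\<^sub>E i\<in>I. U i)"
        "(\<Pi>\<^sub>E i\<in>I. U i) \<subseteq> V"
        using openin_box_topologyD V unfolding TT_def by metis
      \<comment> \<open>A box neighborhood may restrict every coordinate at once; each side
        \<open>U i \<inter> S i\<close> is in \<open>p i\<close> because \<open>p i\<close> is near
        \<open>e i\<close>.\<close>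
      have "(\<Pi>\<^sub>E i\<in>I. U i \<inter> S i) \<in> q"
        using U p by (intro box) (auto simp: mem_e_star_iff ee_def PiE_iff)
      moreover have "(\<Pi>\<^sub>E i\<in>I. U i \<inter> S i) \<subseteq> V \<inter> SS"
        using U(3) by (auto simp: SS_def PiE_Int[symmetric])
      ultimately show ?thesis by (rule ultrafilter_on_mono[OF q]) auto
    qed
    ultimately have "q \<in> M" using q by (simp add: M mem_e_star_iff \<pi>eq)
    then show ?thesis by blast
  qed
  have ufE: "ultrafilter_on SS q" if "q \<in> ?E" for q using that by (simp add: mem_e_star_iff)
  \<comment> \<open>The coordinate maps are homomorphisms and each \<open>p i\<close> is idempotent,
    so the fibre over \<open>pp\<close> is closed under the operation.\<close>
  have Mop: "?op q r \<in> M" if "q \<in> M" "r \<in> M" for q r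
    using that by (simp add: M Eop \<pi>op ufE idem)
  have ME: "M \<subseteq> ?E" by (auto simp: M)

  interpret M: compact_right_topological_semigroup "beta SS" M ?op
    by (rule compact_right_topological_semigroup_beta[OF sgSS Mcompact Mne Mop])
  \<comment> \<open>Nonemptiness of the larger semigroup is inherited from \<open>M\<close>.\<close>
  interpret E: compact_right_topological_semigroup "beta SS" ?E ?op
    using ME Mne by (intro compact_right_topological_semigroup_beta[OF sgSS compactin_e_star _ Eop]) auto
  let ?K = "smallest_ideal ?E ?op"

  obtain m where m: "m \<in> M" "m \<in> ?E" "?op m m = m" using M.idempotent_exists ME by blast
  obtain k where k: "k \<in> ?K" "k \<in> ?E"
    using E.two_sided_ideal_smallest_ideal by (auto simp: two_sided_ideal_def)
  have Kl: "?op x y \<in> ?K" if "x \<in> ?E" "y \<in> ?K" for x y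
    using E.two_sided_ideal_smallest_ideal that by (simp add: two_sided_ideal_def)
  have Kr: "?op y x \<in> ?K" if "x \<in> ?E" "y \<in> ?K" for x y
    using E.two_sided_ideal_smallest_ideal that by (simp add: two_sided_ideal_def)

  \<comment> \<open>The factor \<open>k\<close> puts this compact left ideal inside
    \<open>?K\<close>, and the final factor \<open>m\<close> makes the idempotent \<open>m\<close> a
    right identity on it.\<close>
  define N where "N = (\<lambda>x. ?op x (?op k m)) ` ?E"
  have km: "?op k m \<in> ?E" using k m Eop by blast
  have NE: "N \<subseteq> ?E" using km Eop by (auto simp: N_def)
  interpret N: compact_right_topological_semigroup "beta SS" N ?op
  proof (rule E.subsemigroup[OF NE])
    show "N \<noteq> {}" using k by (auto simp: N_def)
    show "compactin (beta SS) N"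
      unfolding N_def using E.compact km by (intro E.compactin_right_translate) auto
    fix x y assume x: "x \<in> N" and "y \<in> N"
    then obtain b where b: "b \<in> ?E" "y = ?op b (?op k m)" by (auto simp: N_def)
    then have "?op x y = ?op (?op x b) (?op k m)" by (simp add: beta_op_assoc[OF sgSS])
    then show "?op x y \<in> N" using x b NE Eop by (auto simp: N_def)
  qed
  obtain r where r: "r \<in> N" "?op r r = r" using N.idempotent_exists by blast
  have rE: "r \<in> ?E" using r NE by blast
  have rK: "r \<in> ?K" using r k m Kl Kr by (auto simp: N_def)
  have rm: "?op r m = r" using r(1) m by (auto simp: N_def beta_op_assoc[OF sgSS])
  have mm: "?op m (?op m r) = ?op m r" using m by (metis beta_op_assoc[OF sgSS])
  have mrm: "?op (?op m r) m = ?op m r" using rm by (simp add: beta_op_assoc[OF sgSS])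
  \<comment> \<open>Since \<open>r + m = r\<close>, the inner \<open>m\<close> is absorbed and
    \<open>r + r = r\<close> finishes; with the two preceding facts, \<open>m + r\<close> is an
    idempotent below \<open>m\<close>.\<close>
  have mrmr: "?op (?op m r) (?op m r) = ?op m r"
    using r(2) mrm by (metis beta_op_assoc[OF sgSS])
  have mrE: "?op m r \<in> ?E" using m rE Eop by blast
  have "?\<pi> i (?op m r) = p i" if i: "i \<in> I" for i
  proof -
    have \<pi>m: "?\<pi> i m = p i" using m i M by blast
    show ?thesis
    \<comment> \<open>Applying the coordinate homomorphism to the relations between
      \<open>m + r\<close> and \<open>m\<close> gives the same relations with \<open>p i\<close> in
      place of \<open>m\<close>.\<close>
    proof (rule compact_right_topological_semigroup.smallest_ideal_idempotent_minimal[OF Ei[OF i] minimal[OF i]])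
      show "?\<pi> i (?op m r) \<in> ?Ei i"
        using map_uf_in_e_star[where T = T and e = e, OF i e(1)] mrE unfolding SS_def TT_def ee_def by blast
      show "?opi i (?\<pi> i (?op m r)) (?\<pi> i (?op m r)) = ?\<pi> i (?op m r)"
        using \<pi>op[OF i ufE[OF mrE], of "?op m r"] mrmr by simp
      show "?opi i (?\<pi> i (?op m r)) (p i) = ?\<pi> i (?op m r)"
        using \<pi>op[OF i ufE[OF mrE], of m] mrm \<pi>m by simp
      show "?opi i (p i) (?\<pi> i (?op m r)) = ?\<pi> i (?op m r)"
        using \<pi>op[OF i ufE[OF m(2)], of "?op m r"] mm \<pi>m by simp
    qed
  qed
  \<comment> \<open>One common point suffices: \<open>M \<inter> ?K\<close> is then a nonempty ideal
    of \<open>M\<close> and so contains the smallest one.\<close>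
  then have "?op m r \<in> M \<inter> ?K" using mrE Kl m rK by (simp add: M)
  then have "two_sided_ideal M ?op (M \<inter> ?K)"
    using Mop Kl Kr ME unfolding two_sided_ideal_def by blast
  then have "smallest_ideal M ?op \<subseteq> ?K" using M.smallest_ideal_least by blast
  then show ?thesis
    using Mcompact Mne Mop ME by (simp add: subsemigroup_of_def)
qed

end
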